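(* For $\boldsymbol v\in\mathbb R^d$ with $|\boldsymbol v|<c$ set $w(\boldsymbol v)=\ell(-\boldsymbol v)\,g(\boldsymbol v)$. Then $w(\boldsymbol v)\in G_f$, it is the identity on spatial directions orthogonal to $\boldsymbol v$, and $$w(\boldsymbol v)\,Q_c(\boldsymbol v)\,w(\boldsymbol v)^{\mathrm T}=Q_* .$$ For $\boldsymbol v=U\boldsymbol e_1$ with $U=Mc$, $0<M<1$, $\beta=\sqrt{1-M^2}$, the map $w(\boldsymbol v):(t,x_1,\boldsymbol x_\perp)\mapsto(\tau,X_1,\boldsymbol x'_\perp)$ reads explicitly $$\tau=\beta t+\frac{M}{c\beta}x_1,\qquad X_1=\frac{x_1}{\beta},\qquad \boldsymbol x'_\perp=\boldsymbol x_\perp,$$ and its restriction to time-harmonic fields is exactly the correspondence $$P(\boldsymbol x)=e^{\mathrm i\alpha x_1}\,q\Bigl(\frac{x_1}{\beta},\boldsymbol x_\perp\Bigr),\qquad \alpha=-\frac{\omega M}{c\beta^2},$$ between fields $e^{-\mathrm i\omega t}P(\boldsymbol x)$ in the original coordinates and fields $e^{-\mathrm i\omega'\tau}q(X_1,\boldsymbol x'_\perp)$ in the new coordinates, with the frequency shift $\omega\mapsto\omega'=\omega/\beta$ realised by the time coefficient $p=\beta$ of $w(\boldsymbol v)$.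
   Context: Fix $c>0$, $d\in\{2,3\}$; coordinates $(t,\boldsymbol x)\in\mathbb R^{1+d}$. For $|\boldsymbol v|<c$, $\gamma=(1-|\boldsymbol v|^2/c^2)^{-1/2}$, $\hat{\boldsymbol v}=\boldsymbol v/|\boldsymbol v|$ (terms with $\hat{\boldsymbol v}$ read as $0$ if $\boldsymbol v=0$): Galilean map $g(\boldsymbol v):(t,\boldsymbol x)\mapsto(t,\boldsymbol x-\boldsymbol vt)$; Lorentz boost $\ell(\boldsymbol v):(t,\boldsymbol x)\mapsto\bigl(\gamma(t-\boldsymbol v\cdot\boldsymbol x/c^2),\ \boldsymbol x+(\gamma-1)(\hat{\boldsymbol v}\cdot\boldsymbol x)\hat{\boldsymbol v}-\gamma\boldsymbol vt\bigr)$. Both are identified with their matrices. $G_f$ is the group of invertible matrices $\begin{pmatrix}p&\boldsymbol q^{\mathrm T}\\0&S\end{pmatrix}$, $p\ne0$, $S$ invertible $d\times d$. $Q_c(\boldsymbol v)=\begin{pmatrix}1&\boldsymbol v^{\mathrm T}\\ \boldsymbol v&\boldsymbol v\boldsymbol v^{\mathrm T}-c^2I\end{pmatrix}$ is the coefficient matrix of the convected wave operator $(\partial_t+\boldsymbol v\cdot\nabla)^2-c^2\Delta$ and $Q_*=\begin{pmatrix}1&0\\0&-c^2I\end{pmatrix}$ that of $\partial_t^2-c^2\Delta$; under $\xi'=M\xi$ coefficient matrices transform by $Q\mapsto MQM^{\mathrm T}$ and fields by $f'(\xi')=f(M^{-1}\xi')$. $\boldsymbol x_\perp$ denotes the components of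 $\boldsymbol x$ other than $x_1$. *)

theory Defs
  imports "HOL-Analysis.Analysis"
begin

text \<open>
  Space-time \<open>\<real>\<^bsup>1+d\<^esup>\<close> is \<open>real ^ 'n option\<close> with \<open>d = CARD('n)\<close>: the index \<open>None\<close> is the time
  coordinate and \<open>Some i\<close> the \<open>i\<close>-th space coordinate.
\<close>

type_synonym 'n spacetime = "real ^ 'n option"
type_synonym 'n st_matrix = "real ^ 'n option ^ 'n option"

definition event :: "real \<Rightarrow> real ^ 'n \<Rightarrow> 'n spacetime" where
  "event t x = (\<chi> i. case i of None \<Rightarrow> t | Some j \<Rightarrow> x $ j)"

definition time_of :: "('n :: finite) spacetime \<Rightarrow> real" where
  "time_of \<xi> = \<xi> $ None"

definition space_of :: "'n spacetime \<Rightarrow> real ^ 'n" where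
  "space_of \<xi> = (\<chi> j. \<xi> $ Some j)"

text \<open>\<open>block p q r S\<close> has first row \<open>(p, q\<^sup>T)\<close>, first column \<open>(p, r)\<close> and spatial block \<open>S\<close>.\<close>

definition block ::
    "real \<Rightarrow> real ^ 'n \<Rightarrow> real ^ 'n \<Rightarrow> real ^ 'n ^ 'n \<Rightarrow> 'n st_matrix" where
  "block p q r S =
     (\<chi> i j. case i of
        None \<Rightarrow> (case j of None \<Rightarrow> p | Some l \<Rightarrow> q $ l)
      | Some k \<Rightarrow> (case j of None \<Rightarrow> r $ k | Some l \<Rightarrow> S $ k $ l))"

definition time_coeff :: "('n :: finite) st_matrix \<Rightarrow> real" where
  "time_coeff A = A $ None $ None"

definition galilean :: "real ^ 'n \<Rightarrow> 'n spacetime \<Rightarrow> 'n spacetime" where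
  "galilean v \<xi> = event (time_of \<xi>) (space_of \<xi> - time_of \<xi> *\<^sub>R v)"

definition lorentz_factor :: "real \<Rightarrow> real ^ 'n \<Rightarrow> real" where
  "lorentz_factor c v = 1 / sqrt (1 - (norm v)\<^sup>2 / c\<^sup>2)"

text \<open>The direction \<open>v / |v|\<close> is \<open>sgn v\<close>, which is \<open>0\<close> for \<open>v = 0\<close>.\<close>

definition boost :: "real \<Rightarrow> real ^ 'n \<Rightarrow> 'n spacetime \<Rightarrow> 'n spacetime" where
  "boost c v \<xi> =
     (let \<gamma> = lorentz_factor c v; t = time_of \<xi>; x = space_of \<xi> in
      event (\<gamma> * (t - (v \<bullet> x) / c\<^sup>2))
            (x + ((\<gamma> - 1) * (sgn v \<bullet> x)) *\<^sub>R sgn v - (\<gamma> * t) *\<^sub>R v))"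

lemma time_of_event [simp]: "time_of (event t x) = t"
  by (simp add: time_of_def event_def)

lemma space_of_event [simp]: "space_of (event t x) = x"
  by (simp add: space_of_def event_def vec_eq_iff)

lemma event_time_space [simp]: "event (time_of \<xi>) (space_of \<xi>) = \<xi>"
  by (auto simp: event_def time_of_def space_of_def vec_eq_iff split: option.split)

lemma time_of_add [simp]: "time_of (\<xi> + \<eta>) = time_of \<xi> + time_of \<eta>"
  and space_of_add [simp]: "space_of (\<xi> + \<eta>) = space_of \<xi> + space_of \<eta>"
  and time_of_scaleR [simp]: "time_of (r *\<^sub>R \<xi>) = r * time_of \<xi>"
  and space_of_scaleR [simp]: "space_of (r *\<^sub>R \<xi>) = r *\<^sub>R space_of \<xi>"
  by (simp_all add: time_of_def space_of_def vec_eq_iff)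

lemma event_add: "event s x + event t y = event (s + t) (x + y)"
  by (simp add: event_def vec_eq_iff split: option.split)

lemma event_scaleR: "r *\<^sub>R event t x = event (r * t) (r *\<^sub>R x)"
  by (simp add: event_def vec_eq_iff split: option.split)

lemma linear_galilean: "linear (galilean v)"
  by (rule linearI) (simp_all add: galilean_def event_add event_scaleR algebra_simps)

lemma linear_boost: "linear (boost c v)"
  by (rule linearI)
    (simp_all add: boost_def Let_def event_add event_scaleR inner_add_right
      add_divide_distrib algebra_simps)

definition wmat :: "real \<Rightarrow> real ^ 'n \<Rightarrow> 'n st_matrix" where
  "wmat c v = matrix (boost c (- v)) ** matrix (galilean v)"

definition G_f :: "(('n :: finite) st_matrix) set" where
  "G_f = {A. invertible A \<and> (\<exists>p q S. p \<noteq> 0 \<and> invertible S \<and> A = block p q 0 S)}"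

definition Q_conv :: "real \<Rightarrow> real ^ 'n \<Rightarrow> 'n st_matrix" where
  "Q_conv c v = block 1 v v ((\<chi> i j. v $ i * v $ j) - c\<^sup>2 *\<^sub>R mat 1)"

definition Q_star :: "real \<Rightarrow> ('n :: finite) st_matrix" where
  "Q_star c = block 1 0 0 (- (c\<^sup>2 *\<^sub>R mat 1))"

definition transform_field ::
    "('n :: finite) st_matrix \<Rightarrow> ('n spacetime \<Rightarrow> complex) \<Rightarrow> 'n spacetime \<Rightarrow> complex" where
  "transform_field A f \<xi> = f (matrix_inv A *v \<xi>)"

definition time_harmonic :: "real \<Rightarrow> (real ^ 'n \<Rightarrow> complex) \<Rightarrow> 'n spacetime \<Rightarrow> complex" where
  "time_harmonic \<omega> P \<xi> = exp (- (\<i> * of_real \<omega> * of_real (time_of \<xi>))) * P (space_of \<xi>)"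

text \<open>
  The first spatial index is \<open>1 :: 'n\<close>, so that \<open>axis 1 1\<close> is the first unit vector. The class
  \<open>one\<close> only designates an index; the numeral types \<open>2\<close> and \<open>3\<close> are instances.
  \<open>with_first a x\<close> is the point \<open>(a, x\<^sub>\<bottom>)\<close>, where \<open>x\<^sub>\<bottom>\<close> are the components of \<open>x\<close> other
  than the first.
\<close>

definition with_first :: "real \<Rightarrow> real ^ ('n :: {finite, one}) \<Rightarrow> real ^ ('n :: {finite, one})" where
  "with_first a x = (\<chi> i. if i = 1 then a else x $ i)"

end

theory Submission
  imports Defs
begin

text \<open>
  The shear part of the boost cancels against the Galilean shift: with \<open>\<gamma>\<close> the Lorentz factor,
  \<open>w(v)\<close> sends \<open>(t, x)\<close> to \<open>(t/\<gamma> + \<gamma> v\<cdot>x/c\<^sup>2, S x)\<close>, where \<open>S\<close> is the symmetric map stretching the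
  direction of \<open>v\<close> by \<open>\<gamma>\<close>. This gives the block form, and since \<open>S v = \<gamma> v\<close> the congruence of
  the wave operators is checked by applying both sides to a vector. The correspondence of
  time-harmonic fields is the equation \<open>f \<xi> = f' (w \<xi>)\<close> written out, because \<open>w(v)\<close> is a bijection;
  comparing the time dependence at a point where \<open>P\<close> does not vanish determines the frequency.
\<close>

section \<open>Block matrices and the wave operators acting on events\<close>

lemma sum_UNIV_option:
  fixes f :: "'n :: finite option \<Rightarrow> 'b :: comm_monoid_add"
  shows "sum f UNIV = f None + (\<Sum>i\<in>UNIV. f (Some i))"
  by (simp add: UNIV_option_conv sum.reindex)

lemma event_eq_iff: "event s x = event t y \<longleftrightarrow> s = t \<and> x = y"
  by (metis space_of_event time_of_event)

lemma all_event_iff: "(\<forall>\<xi>. R \<xi>) \<longleftrightarrow> (\<forall>t x. R (event t x))"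
  by (metis event_time_space)

lemma block_mult_event:
  "block p q r S *v event t x = event (p * t + q \<bullet> x) (t *\<^sub>R r + S *v x)"
  by (auto simp: vec_eq_iff matrix_vector_mult_def block_def event_def sum_UNIV_option
      inner_vec_def split: option.split)

lemma transpose_block: "transpose (block p q r S) = block p r q (transpose S)"
  by (auto simp: vec_eq_iff transpose_def block_def split: option.split)

lemma matrix_eq_event: "A = B \<longleftrightarrow> (\<forall>t x. A *v event t x = B *v event t x)"
  by (simp add: matrix_eq all_event_iff)

lemma outer_product_mult: "(\<chi> i j. u $ i * w $ j) *v x = (w \<bullet> x) *\<^sub>R (u :: real ^ 'n)"
  by (simp add: vec_eq_iff matrix_vector_mult_def inner_vec_def sum_distrib_left mult_ac)

lemma scaleR_mat_mult: "(a *\<^sub>R mat 1) *v x = a *\<^sub>R (x :: real ^ 'n)"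
  by (simp flip: scaleR_matrix_vector_assoc)

text \<open>The projection of v onto its own direction is v. For v = 0 both sides vanish because
  \<open>sgn 0 = 0\<close>, so \<open>stretch_mult_self\<close> needs no case split.\<close>

lemma inner_sgn_scaleR_sgn: "(sgn v \<bullet> v) *\<^sub>R sgn v = (v :: 'a :: real_inner)"
  by (cases "v = 0") (simp_all add: sgn_div_norm dot_square_norm power2_eq_square
      field_simps)

lemma Q_conv_mult_event:
  "Q_conv c v *v event t x = event (t + v \<bullet> x) ((t + v \<bullet> x) *\<^sub>R v - c\<^sup>2 *\<^sub>R x)"
  by (simp add: Q_conv_def block_mult_event matrix_vector_mult_diff_rdistrib outer_product_mult
      scaleR_mat_mult event_eq_iff scaleR_add_left)

lemma Q_star_mult_event: "Q_star c *v event t x = event t (- (c\<^sup>2 *\<^sub>R x))"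
  by (simp add: Q_star_def block_mult_event scaleR_mat_mult event_eq_iff
      flip: scaleR_minus_left)

section \<open>Stretching space along the direction of v\<close>

definition stretch :: "real \<Rightarrow> real ^ 'n \<Rightarrow> real ^ 'n ^ 'n" where
  "stretch a v = mat 1 + (a - 1) *\<^sub>R (\<chi> i j. sgn v $ i * sgn v $ j)"

lemma stretch_mult: "stretch a v *v x = x + ((a - 1) * (sgn v \<bullet> x)) *\<^sub>R sgn v"
  by (simp add: stretch_def matrix_vector_mult_add_rdistrib outer_product_mult
      flip: scaleR_matrix_vector_assoc)

lemma transpose_stretch: "transpose (stretch a v) = stretch a v"
  by (auto simp: vec_eq_iff stretch_def transpose_def mat_def)

lemma stretch_mult_self: "stretch a v *v v = a *\<^sub>R v"
proof -
  have "stretch a v *v v = v + (a - 1) *\<^sub>R ((sgn v \<bullet> v) *\<^sub>R sgn v)"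
    by (simp add: stretch_mult)
  then show ?thesis
    by (simp only: inner_sgn_scaleR_sgn) (simp add: algebra_simps)
qed

text \<open>By symmetry the stretch moves to the other factor v, which is an eigenvector with
  eigenvalue a.\<close>

lemma inner_stretch: "v \<bullet> (stretch a v *v x) = a * (v \<bullet> x)"
  by (metis dot_lmul_matrix inner_scaleR_left stretch_mult_self transpose_stretch
      transpose_matrix_vector)

text \<open>The eigenvalues along v multiply and the orthogonal complement stays fixed. For v = 0
  every stretch is the identity.\<close>

lemma stretch_stretch: "stretch a v *v (stretch b v *v x) = stretch (a * b) v *v x"
proof (cases "v = 0")
  case False
  then have "sgn v \<bullet> sgn v = 1"
    by (simp add: dot_square_norm norm_sgn)
  then show ?thesis
    by (simp add: stretch_mult inner_add_right algebra_simps)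
qed (simp add: stretch_mult)

lemma stretch_1: "stretch 1 v = mat 1"
  by (simp add: stretch_def)

lemma invertible_stretch:
  assumes "a \<noteq> 0"
  shows "invertible (stretch a v)"
proof -
  have "stretch (1 / a) v ** stretch a v = mat 1"
    using assms by (simp add: matrix_eq stretch_stretch stretch_1 flip: matrix_vector_mul_assoc)
  then show ?thesis
    using invertible_left_inverse by blast
qed

section \<open>The map w(v) for an arbitrary velocity below c\<close>

context
  fixes c :: real and v :: "real ^ 'n"
  assumes c: "c > 0" and v: "norm v < c"
begin

lemma lorentz_factor_pos: "lorentz_factor c v > 0"
proof -
  have "(norm v)\<^sup>2 < c\<^sup>2"
    using c v by (simp add: power_strict_mono)
  then show ?thesis
    using c by (simp add: lorentz_factor_def)
qed

text \<open>This is \<gamma>^2 = c^2 / (c^2 - |v|^2) with denominators cleared; it is the only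
  relation between \<gamma> and v used below, and it serves to eliminate v \<bullet> v.\<close>

lemma norm_sq_lorentz_factor: "(lorentz_factor c v)\<^sup>2 * (v \<bullet> v) = ((lorentz_factor c v)\<^sup>2 - 1) * c\<^sup>2"
proof -
  have "(norm v)\<^sup>2 < c\<^sup>2"
    using c v by (simp add: power_strict_mono)
  then have pos: "c\<^sup>2 - (norm v)\<^sup>2 > 0" "1 - (norm v)\<^sup>2 / c\<^sup>2 > 0"
    using c by simp_all
  then have "(lorentz_factor c v)\<^sup>2 = 1 / (1 - (norm v)\<^sup>2 / c\<^sup>2)"
    by (simp add: lorentz_factor_def power_one_over)
  also have "\<dots> = c\<^sup>2 / (c\<^sup>2 - (norm v)\<^sup>2)"
    using c pos by (simp add: field_simps)
  finally have "(lorentz_factor c v)\<^sup>2 = c\<^sup>2 / (c\<^sup>2 - (norm v)\<^sup>2)" .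
  then show ?thesis
    using pos by (simp add: dot_square_norm field_simps)
qed

lemma wmat_mult_event_stretch:
  defines "\<gamma> \<equiv> lorentz_factor c v"
  shows "wmat c v *v event t x = event (t / \<gamma> + \<gamma> / c\<^sup>2 * (v \<bullet> x)) (stretch \<gamma> v *v x)"
proof -
  \<comment> \<open>The Lorentz factor is even in v, so the inverse boost has the same
    \<gamma>.\<close>
  have "lorentz_factor c (- v) = \<gamma>"
    by (simp add: \<gamma>_def lorentz_factor_def)
  then have "wmat c v *v event t x = event (\<gamma> * (t + (v \<bullet> (x - t *\<^sub>R v)) / c\<^sup>2))
      (stretch \<gamma> v *v (x - t *\<^sub>R v) + (\<gamma> * t) *\<^sub>R v)"
    unfolding wmat_def
    by (simp add: matrix_vector_mul(2)[OF linear_boost, THEN fun_cong]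
        matrix_vector_mul(2)[OF linear_galilean, THEN fun_cong] galilean_def
        boost_def Let_def sgn_minus stretch_mult
        flip: matrix_vector_mul_assoc)
  moreover have "\<gamma> * (t + (v \<bullet> (x - t *\<^sub>R v)) / c\<^sup>2) = t / \<gamma> + \<gamma> / c\<^sup>2 * (v \<bullet> x)"
  proof -
    have "\<gamma> > 0" "\<gamma>\<^sup>2 * (v \<bullet> v) = (\<gamma>\<^sup>2 - 1) * c\<^sup>2"
      using lorentz_factor_pos norm_sq_lorentz_factor by (simp_all add: \<gamma>_def)
    \<comment> \<open>This value turns the time coefficient \<gamma> - \<gamma> |v|^2 / c^2 into 1 /
      \<gamma>.\<close>
    then have vv: "\<gamma> * (v \<bullet> v) / c\<^sup>2 = \<gamma> - 1 / \<gamma>"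
      using c by (simp add: field_simps) (simp add: power2_eq_square mult_ac)
    have "\<gamma> * (t + (v \<bullet> (x - t *\<^sub>R v)) / c\<^sup>2)
        = \<gamma> * t + \<gamma> / c\<^sup>2 * (v \<bullet> x) - t * (\<gamma> * (v \<bullet> v) / c\<^sup>2)"
      by (simp add: inner_diff_right diff_divide_distrib algebra_simps)
    then show ?thesis
      unfolding vv by (simp add: algebra_simps)
  qed
  \<comment> \<open>The Galilean shift -t v is stretched to -\<gamma> t v, which cancels the boost's
    own shift.\<close>
  moreover have "stretch \<gamma> v *v (x - t *\<^sub>R v) + (\<gamma> * t) *\<^sub>R v = stretch \<gamma> v *v x"
    by (simp add: matrix_vector_mult_diff_distrib matrix_vector_mult_scaleR stretch_mult_self)
  ultimately show ?thesis
    by simp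
qed

lemma wmat_eq_block:
  defines "\<gamma> \<equiv> lorentz_factor c v"
  shows "wmat c v = block (1 / \<gamma>) ((\<gamma> / c\<^sup>2) *\<^sub>R v) 0 (stretch \<gamma> v)"
  by (simp add: matrix_eq_event wmat_mult_event_stretch block_mult_event \<gamma>_def)

text \<open>Block triangularity: the space part determines x because the stretch is invertible, and
  then the time part determines t because its coefficient 1 / \<gamma> is nonzero.\<close>

lemma invertible_wmat: "invertible (wmat c v)"
proof -
  have "inj ((*v) (wmat c v))"
  proof (rule injI)
    fix \<xi> \<eta>
    assume eq: "wmat c v *v \<xi> = wmat c v *v \<eta>"
    obtain t x s y where \<xi>: "\<xi> = event t x" and \<eta>: "\<eta> = event s y"
      by (metis event_time_space)
    have "x = y"
      using eq invertible_stretch[of "lorentz_factor c v" v] lorentz_factor_pos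
      by (metis \<xi> \<eta> event_eq_iff inj_eq inj_matrix_vector_mult less_irrefl wmat_mult_event_stretch)
    then show "\<xi> = \<eta>"
      using eq lorentz_factor_pos by (simp add: \<xi> \<eta> wmat_mult_event_stretch event_eq_iff)
  qed
  then show ?thesis
    by (simp add: invertible_left_inverse matrix_left_invertible_injective)
qed

lemma wmat_in_G_f: "wmat c v \<in> G_f"
proof -
  have "lorentz_factor c v \<noteq> 0"
    using lorentz_factor_pos by simp
  then have "1 / lorentz_factor c v \<noteq> 0" "invertible (stretch (lorentz_factor c v) v)"
    by (simp_all add: invertible_stretch)
  then show ?thesis
    unfolding G_f_def using invertible_wmat wmat_eq_block by blast
qed

lemma wmat_orthogonal:
  assumes "v \<bullet> y = 0"
  shows "wmat c v *v event 0 y = event 0 y"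
  using assms by (simp add: wmat_mult_event_stretch stretch_mult sgn_div_norm)

lemma wmat_congruence: "wmat c v ** Q_conv c v ** transpose (wmat c v) = Q_star c"
  unfolding matrix_eq_event
proof (intro allI)
  fix t x
  define \<gamma> where "\<gamma> = lorentz_factor c v"
  define S where "S = stretch \<gamma> v"
  have \<gamma>: "\<gamma> > 0" and vv: "\<gamma>\<^sup>2 * (v \<bullet> v) = (\<gamma>\<^sup>2 - 1) * c\<^sup>2"
    using lorentz_factor_pos norm_sq_lorentz_factor by (simp_all add: \<gamma>_def)
  \<comment> \<open>The vector y is the space part of the transposed map applied to (t, x).\<close>
  define y where "y = (\<gamma> * t / c\<^sup>2) *\<^sub>R v + S *v x"
  have wT: "transpose (wmat c v) *v event t x = event (t / \<gamma>) y"
    by (simp add: wmat_eq_block transpose_block transpose_stretch block_mult_event y_def S_def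
        \<gamma>_def event_eq_iff mult_ac)
  have "v \<bullet> y = t * (\<gamma>\<^sup>2 * (v \<bullet> v)) / (\<gamma> * c\<^sup>2) + \<gamma> * (v \<bullet> x)"
    using \<gamma> by (simp add: y_def S_def inner_add_right inner_stretch power2_eq_square)
  also have "t * (\<gamma>\<^sup>2 * (v \<bullet> v)) / (\<gamma> * c\<^sup>2) = \<gamma> * t - t / \<gamma>"
    unfolding vv using \<gamma> c by (simp add: field_simps power2_eq_square)
  finally have time: "t / \<gamma> + v \<bullet> y = \<gamma> * (t + v \<bullet> x)"
    by (simp add: algebra_simps)
  \<comment> \<open>Likewise z is the space part after the convected operator has been applied; the
    third factor must send it, with its time part, to (t, -c^2 x).\<close>
  define z where "z = (\<gamma> * (t + v \<bullet> x)) *\<^sub>R v - c\<^sup>2 *\<^sub>R y"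
  have Q: "Q_conv c v *v event (t / \<gamma>) y = event (\<gamma> * (t + v \<bullet> x)) z"
    by (simp only: Q_conv_mult_event time z_def)
  \<comment> \<open>The extra factor \<gamma> produces \<gamma>^2 |v|^2, to which \<open>vv\<close>
    applies. The result is -c^2 (v \<bullet> x), which cancels the v \<bullet> x in the time
    part.\<close>
  have "\<gamma> * (v \<bullet> z) = (t + v \<bullet> x) * (\<gamma>\<^sup>2 * (v \<bullet> v)) - c\<^sup>2 * (\<gamma> * (v \<bullet> y))"
    by (simp add: z_def inner_diff_right power2_eq_square algebra_simps)
  also have "\<dots> = c\<^sup>2 * (t - (t + v \<bullet> x))"
  proof -
    have "\<gamma> * (v \<bullet> y) = \<gamma>\<^sup>2 * (t + v \<bullet> x) - t"
      using time \<gamma> by (simp add: field_simps power2_eq_square)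
    then show ?thesis
      by (simp only: vv) (simp add: algebra_simps)
  qed
  finally have w_time: "\<gamma> * (t + v \<bullet> x) / \<gamma> + \<gamma> / c\<^sup>2 * (v \<bullet> z) = t"
    using \<gamma> c by (simp add: field_simps)
  have "S *v z = (\<gamma>\<^sup>2 * (t + v \<bullet> x)) *\<^sub>R v - (\<gamma>\<^sup>2 * t) *\<^sub>R v - c\<^sup>2 *\<^sub>R (S *v (S *v x))"
    using c by (simp add: z_def y_def S_def matrix_vector_mult_diff_distrib
        matrix_vector_right_distrib matrix_vector_mult_scaleR stretch_mult_self power2_eq_square
        algebra_simps)
  \<comment> \<open>S^2 is the stretch by \<gamma>^2. Its excess over the identity, times c^2, is
    \<gamma>^2 (v \<bullet> x) v by \<open>vv\<close>, and this cancels what remains of the two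
    terms along v.\<close>
  also have "S *v (S *v x) = x + ((\<gamma>\<^sup>2 - 1) * (sgn v \<bullet> x)) *\<^sub>R sgn v"
    by (simp add: S_def stretch_stretch power2_eq_square) (simp add: stretch_mult)
  also have "c\<^sup>2 *\<^sub>R (x + ((\<gamma>\<^sup>2 - 1) * (sgn v \<bullet> x)) *\<^sub>R sgn v)
      = c\<^sup>2 *\<^sub>R x + (\<gamma>\<^sup>2 * (v \<bullet> v) * (sgn v \<bullet> x)) *\<^sub>R sgn v"
    unfolding vv by (simp add: algebra_simps)
  also have "(\<gamma>\<^sup>2 * (v \<bullet> v) * (sgn v \<bullet> x)) *\<^sub>R sgn v = (\<gamma>\<^sup>2 * (v \<bullet> x)) *\<^sub>R v"
    by (cases "v = 0") (simp_all add: sgn_div_norm dot_square_norm power2_eq_square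
        field_simps)
  finally have w_space: "S *v z = - (c\<^sup>2 *\<^sub>R x)"
    by (simp add: algebra_simps)
  have "wmat c v *v event (\<gamma> * (t + v \<bullet> x)) z = event t (- (c\<^sup>2 *\<^sub>R x))"
    using w_time w_space by (simp add: wmat_mult_event_stretch \<gamma>_def S_def)
  then show "(wmat c v ** Q_conv c v ** transpose (wmat c v)) *v event t x = Q_star c *v event t x"
    by (simp only: wT Q Q_star_mult_event flip: matrix_vector_mul_assoc)
qed

end

section \<open>Transformed fields and the recognition of a zero frequency\<close>

lemma transform_field_eq_iff:
  assumes "invertible A"
  shows "transform_field A f = h \<longleftrightarrow> (\<forall>\<xi>. f \<xi> = h (A *v \<xi>))"
proof -
  \<comment> \<open>\<open>matrix_inv\<close> is defined by choice; invertibility provides a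
    candidate, so the chosen matrix is a two-sided inverse.\<close>
  have "A ** matrix_inv A = mat 1 \<and> matrix_inv A ** A = mat 1"
    using assms unfolding invertible_def matrix_inv_def by (rule someI_ex)
  then have "A *v (matrix_inv A *v \<xi>) = \<xi>" "matrix_inv A *v (A *v \<xi>) = \<xi>" for \<xi>
    by (simp_all add: matrix_vector_mul_assoc)
  then show ?thesis
    unfolding fun_eq_iff transform_field_def by metis
qed

text \<open>For nonzero a the time t = pi / a would give the value -1.\<close>

lemma exp_i_mult_eq_1_imp:
  assumes "\<And>t :: real. exp (\<i> * of_real (a * t)) = 1"
  shows "a = 0"
proof (rule ccontr)
  assume "a \<noteq> 0"
  then have "exp (\<i> * of_real (a * (pi / a))) = - 1"
    by (simp add: exp_pi_i)
  with assms show False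
    by (metis one_neq_neg_one)
qed

lemma with_first_with_first: "with_first a (with_first b x) = with_first a x"
  by (simp add: with_first_def vec_eq_iff)

lemma with_first_nth_1 [simp]: "with_first a x $ 1 = a"
  by (simp add: with_first_def)

lemma with_first_same [simp]: "with_first (x $ 1) x = x"
  by (simp add: with_first_def vec_eq_iff)

section \<open>Velocity along the first axis and time-harmonic fields\<close>

context
  fixes c M \<beta> :: real and v :: "real ^ ('n :: {finite, one})"
  assumes c: "c > 0" and M: "0 < M" "M < 1" and \<beta>_eq: "\<beta> = sqrt (1 - M\<^sup>2)"
    and v_eq: "v = (M * c) *\<^sub>R axis 1 1"
begin

lemma \<beta>_pos: "\<beta> > 0"
  using M by (simp add: \<beta>_eq power_less_one_iff)

lemma norm_v: "norm v = M * c"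
  using c M by (simp add: v_eq)

lemma norm_v_less: "norm v < c"
  using c M by (simp add: norm_v)

lemma lorentz_factor_v: "lorentz_factor c v = 1 / \<beta>"
  using c by (simp add: lorentz_factor_def norm_v \<beta>_eq power_mult_distrib)

lemma wmat_mult_event:
  "wmat c v *v event t x =
    event (\<beta> * t + M / (c * \<beta>) * x $ 1) (with_first (x $ 1 / \<beta>) x)"
proof -
  \<comment> \<open>Positivity of M c fixes the direction as the first unit vector itself.\<close>
  have "sgn v = axis 1 1"
    using c M by (simp add: v_eq sgn_div_norm field_simps)
  then have "stretch (1 / \<beta>) v *v x = x + ((1 / \<beta> - 1) * x $ 1) *\<^sub>R axis 1 1"
    by (simp add: stretch_mult inner_axis')
  also have "\<dots> = with_first (x $ 1 / \<beta>) x"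
    by (auto simp: vec_eq_iff with_first_def axis_def algebra_simps)
  finally have "stretch (1 / \<beta>) v *v x = with_first (x $ 1 / \<beta>) x" .
  moreover have "v \<bullet> x = M * c * x $ 1"
    by (simp add: v_eq inner_axis')
  ultimately show ?thesis
    using c by (simp add: wmat_mult_event_stretch[OF c norm_v_less] lorentz_factor_v event_eq_iff
        field_simps power2_eq_square)
qed

lemma time_coeff_wmat: "time_coeff (wmat c v) = \<beta>"
  by (simp add: wmat_eq_block[OF c norm_v_less] time_coeff_def block_def lorentz_factor_v)

text \<open>Both frequencies are left free here, so that the equation serves the correspondence at
  \<omega>' = \<omega> / \<beta> as well as the proof that no other frequency can occur.\<close>

lemma transform_time_harmonic_iff:
  "transform_field (wmat c v) (time_harmonic \<omega> P) = time_harmonic \<omega>' q \<longleftrightarrow>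
    (\<forall>t x. exp (- (\<i> * of_real \<omega> * of_real t)) * P x =
       exp (- (\<i> * of_real \<omega>' * of_real (\<beta> * t + M / (c * \<beta>) * x $ 1)))
         * q (with_first (x $ 1 / \<beta>) x))"
  by (simp only: transform_field_eq_iff[OF invertible_wmat[OF c norm_v_less]] all_event_iff
      wmat_mult_event time_harmonic_def time_of_event space_of_event)

lemma transform_time_harmonic_shifted_iff:
  assumes "\<omega>' = \<omega> / \<beta>" and "\<alpha> = - (\<omega> * M / (c * \<beta>\<^sup>2))"
  shows "transform_field (wmat c v) (time_harmonic \<omega> P) = time_harmonic \<omega>' q \<longleftrightarrow>
    (\<forall>x. P x = exp (\<i> * of_real \<alpha> * of_real (x $ 1)) * q (with_first (x $ 1 / \<beta>) x))"
proof -
  \<comment> \<open>The choice of \<omega>' makes the t-part of the phase agree with the original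
    one, and \<alpha> collects the x1-part. The common nonvanishing factor in t then cancels,
    leaving a condition on x alone.\<close>
  have phase: "exp (- (\<i> * of_real \<omega>' * of_real (\<beta> * t + M / (c * \<beta>) * x1)))
      = exp (- (\<i> * of_real \<omega> * of_real t)) * exp (\<i> * of_real \<alpha> * of_real x1)" for t x1 :: real
  proof -
    have "- (\<omega>' * (\<beta> * t + M / (c * \<beta>) * x1)) = - (\<omega> * t) + \<alpha> * x1"
      using \<beta>_pos c by (simp add: assms field_simps power2_eq_square)
    then have "\<i> * of_real (- (\<omega>' * (\<beta> * t + M / (c * \<beta>) * x1))) = \<i> * of_real (- (\<omega> * t) + \<alpha> * x1)"
      by (simp only:)
    then show ?thesis
      by (simp add: algebra_simps flip: exp_add)
  qed
  show ?thesis
    unfolding transform_time_harmonic_iff phase by (simp add: mult.assoc)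
qed

lemma transform_range_time_harmonic:
  assumes "\<omega>' = \<omega> / \<beta>"
  shows "transform_field (wmat c v) ` range (time_harmonic \<omega>) = range (time_harmonic \<omega>')"
proof -
  define \<alpha> where "\<alpha> = - (\<omega> * M / (c * \<beta>\<^sup>2))"
  note iff = transform_time_harmonic_shifted_iff[OF assms \<alpha>_def]
  show ?thesis
  proof (intro equalityI subsetI)
    fix h :: "'n spacetime \<Rightarrow> complex"
    assume "h \<in> transform_field (wmat c v) ` range (time_harmonic \<omega>)"
    then obtain P where h: "h = transform_field (wmat c v) (time_harmonic \<omega> P)"
      by blast
    \<comment> \<open>The witness is the correspondence solved for q by substituting x1 = \<beta>
      X1.\<close>
    have "h = time_harmonic \<omega>'
        (\<lambda>X. exp (- (\<i> * of_real \<alpha> * of_real (\<beta> * X $ 1))) * P (with_first (\<beta> * X $ 1) X))"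
      unfolding h iff using \<beta>_pos
      by (simp add: with_first_with_first exp_minus)
    then show "h \<in> range (time_harmonic \<omega>')"
      by blast
  next
    fix h :: "'n spacetime \<Rightarrow> complex"
    assume "h \<in> range (time_harmonic \<omega>')"
    then obtain q where h: "h = time_harmonic \<omega>' q"
      by blast
    have "transform_field (wmat c v) (time_harmonic \<omega>
        (\<lambda>x. exp (\<i> * of_real \<alpha> * of_real (x $ 1)) * q (with_first (x $ 1 / \<beta>) x))) = h"
      unfolding h iff by simp
    then show "h \<in> transform_field (wmat c v) ` range (time_harmonic \<omega>)"
      by blast
  qed
qed

lemma transform_time_harmonic_frequency:
  assumes "P \<noteq> (\<lambda>x. 0)"
    and "transform_field (wmat c v) (time_harmonic \<omega> P) = time_harmonic \<omega>'' q"
  shows "\<omega>'' = \<omega> / \<beta>"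
proof -
  obtain x where x: "P x \<noteq> 0"
    using assms(1) by blast
  \<comment> \<open>K gathers everything on the right that does not depend on t; evaluation at t = 0
    identifies it with P x, which is nonzero and can be cancelled.\<close>
  define K where "K = exp (- (\<i> * of_real \<omega>'' * of_real (M / (c * \<beta>) * x $ 1)))
    * q (with_first (x $ 1 / \<beta>) x)"
  have *: "exp (- (\<i> * of_real \<omega> * of_real t)) * P x
      = exp (- (\<i> * of_real \<omega>'' * of_real (\<beta> * t))) * K" for t
    using assms(2) unfolding transform_time_harmonic_iff K_def
    by (simp add: distrib_left flip: mult.assoc exp_add)
  have "K = P x"
    using *[of 0] by simp
  have "exp (\<i> * of_real ((\<omega>'' * \<beta> - \<omega>) * t)) = 1" for t
  proof -
    have "exp (- (\<i> * of_real \<omega> * of_real t)) = exp (- (\<i> * of_real \<omega>'' * of_real (\<beta> * t)))"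
      using *[of t] x \<open>K = P x\<close> by simp
    then have "exp (\<i> * of_real \<omega>'' * of_real (\<beta> * t)) * exp (- (\<i> * of_real \<omega> * of_real t)) = 1"
      by (simp add: exp_minus)
    then show ?thesis
      by (simp add: algebra_simps flip: exp_add)
  qed
  then have "\<omega>'' * \<beta> - \<omega> = 0"
    by (rule exp_i_mult_eq_1_imp)
  then show ?thesis
    using \<beta>_pos by (simp add: field_simps)
qed

end

text \<open>Exactness of the correspondence is expressed in three ways: equality of the images of
  the two families of fields, an equivalence for each pair P, q, and uniqueness of the new
  frequency. Uniqueness excludes P = 0, since the zero field is time-harmonic at every
  frequency.\<close>

theorem lemma9:
  fixes c :: real
  assumes "c > 0" and "CARD('n :: {finite, one}) \<in> {2, 3}"
  shows
    "(\<forall>v :: real ^ ('n :: {finite, one}). norm v < c \<longrightarrow>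
        wmat c v \<in> G_f \<and>
        (\<forall>y. v \<bullet> y = 0 \<longrightarrow> wmat c v *v event 0 y = event 0 y) \<and>
        wmat c v ** Q_conv c v ** transpose (wmat c v) = Q_star c)
   \<and> (\<forall>(M :: real) U \<beta> (v :: real ^ ('n :: {finite, one})).
        0 < M \<and> M < 1 \<and> U = M * c \<and> \<beta> = sqrt (1 - M\<^sup>2) \<and> v = U *\<^sub>R axis 1 1 \<longrightarrow>
        (\<forall>t x. wmat c v *v event t x =
                 event (\<beta> * t + M / (c * \<beta>) * x $ 1) (with_first (x $ 1 / \<beta>) x)) \<and>
        time_coeff (wmat c v) = \<beta> \<and>
        (\<forall>\<omega> \<omega>' \<alpha>. \<omega>' = \<omega> / \<beta> \<and> \<alpha> = - (\<omega> * M / (c * \<beta>\<^sup>2)) \<longrightarrow>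
           transform_field (wmat c v) ` range (time_harmonic \<omega>) = range (time_harmonic \<omega>') \<and>
           (\<forall>P q. transform_field (wmat c v) (time_harmonic \<omega> P) = time_harmonic \<omega>' q \<longleftrightarrow>
              (\<forall>x. P x = exp (\<i> * of_real \<alpha> * of_real (x $ 1)) * q (with_first (x $ 1 / \<beta>) x))) \<and>
           (\<forall>P q \<omega>''. P \<noteq> (\<lambda>x. 0) \<and>
              transform_field (wmat c v) (time_harmonic \<omega> P) = time_harmonic \<omega>'' q \<longrightarrow> \<omega>'' = \<omega>')))"
proof (intro conjI allI impI)
  fix v :: "real ^ ('n :: {finite, one})"
  assume v: "norm v < c"
  show "wmat c v \<in> G_f"
    using assms(1) v by (rule wmat_in_G_f)
  show "wmat c v *v event 0 y = event 0 y" if "v \<bullet> y = 0" for y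
    using assms(1) v that by (rule wmat_orthogonal)
  show "wmat c v ** Q_conv c v ** transpose (wmat c v) = Q_star c"
    using assms(1) v by (rule wmat_congruence)
next
  fix M U \<beta> :: real and v :: "real ^ ('n :: {finite, one})"
  assume "0 < M \<and> M < 1 \<and> U = M * c \<and> \<beta> = sqrt (1 - M\<^sup>2) \<and> v = U *\<^sub>R axis 1 1"
  then have *: "0 < M" "M < 1" "\<beta> = sqrt (1 - M\<^sup>2)" "v = (M * c) *\<^sub>R axis 1 1"
    by simp_all
  note ctx = assms(1) *
  show "wmat c v *v event t x =
      event (\<beta> * t + M / (c * \<beta>) * x $ 1) (with_first (x $ 1 / \<beta>) x)" for t x
    by (rule wmat_mult_event[OF ctx])
  show "time_coeff (wmat c v) = \<beta>"
    by (rule time_coeff_wmat[OF ctx])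
  fix \<omega> \<omega>' \<alpha> :: real
  assume "\<omega>' = \<omega> / \<beta> \<and> \<alpha> = - (\<omega> * M / (c * \<beta>\<^sup>2))"
  then have \<omega>': "\<omega>' = \<omega> / \<beta>" and \<alpha>: "\<alpha> = - (\<omega> * M / (c * \<beta>\<^sup>2))"
    by simp_all
  show "transform_field (wmat c v) ` range (time_harmonic \<omega>) = range (time_harmonic \<omega>')"
    by (rule transform_range_time_harmonic[OF ctx \<omega>'])
  show "transform_field (wmat c v) (time_harmonic \<omega> P) = time_harmonic \<omega>' q \<longleftrightarrow>
      (\<forall>x. P x = exp (\<i> * of_real \<alpha> * of_real (x $ 1)) * q (with_first (x $ 1 / \<beta>) x))" for P q
    by (rule transform_time_harmonic_shifted_iff[OF ctx \<omega>' \<alpha>])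
  show "\<omega>'' = \<omega>'" if "P \<noteq> (\<lambda>x. 0) \<and>
      transform_field (wmat c v) (time_harmonic \<omega> P) = time_harmonic \<omega>'' q" for P q \<omega>''
    using transform_time_harmonic_frequency[OF ctx] that \<omega>' by blast
qed

end
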